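(* Let $p\ge1$, $b\in\mathbb C$, $\boldsymbol\kappa\in\mathbb C^p$ with $\kappa_i-\kappa_h\notin\mathbb Z$ for $i\ne h$ and $c_i:=\kappa_i+b+1\notin\{0,-1,-2,\dots\}$ for all $i$. Let $\boldsymbol n\in\mathbb N_0^p$, choose $i_*$ with $n_*:=n_{i_*}=\max_in_i$, put $c_*=c_{i_*}$, and let $\mathcal Q_{\boldsymbol n}$ be the characteristic polynomial defined in the context. Let $\boldsymbol n^{*i_*}=(n_h)_{h\ne i_*}$. For $h\ne i_*$ define $\alpha_h=-c_h-|\boldsymbol n|-n_h$, let $\beta=c_*+n_*-1$, and consider on $\{0,\dots,|\boldsymbol n|\}$ the $p-1$ Hahn weights $$\omega_h(y)=\frac{(\alpha_h+1)_y}{y!}\,\frac{(\beta+1)_{|\boldsymbol n|-y}}{(|\boldsymbol n|-y)!},\qquad h\ne i_* .$$ Then $$\sum_{y=0}^{|\boldsymbol n|}\mathcal Q_{\boldsymbol n}(|\boldsymbol n|-y)\,(-y)_k\,\omega_h(y)=0,\qquad k\in\{0,\dots,n_h-1\},\ h\ne i_*,$$ which are precisely the type-II multiple Hahn orthogonality conditions for the multi-index $\boldsymbol n^{*i_*}$. Whenever this multiple Hahn index is normal, with monic type-II multiple Hahn polynomial $H_{\boldsymbol n^{*i_*}}(y)$, $$\mathcal Q_{\boldsymbol n}(x)=(-1)^{|\boldsymbol n|-n_*}L_{\boldsymbol n}\,H_{\boldsymbol n^{*i_*}}(|\boldsymbol n|-x),\qquad L_{\boldsymbol n}=[x^{|\boldsymbol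 n|-n_*}]\mathcal Q_{\boldsymbol n}(x)=\frac{\prod_{h\ne i_*}(\kappa_h-\kappa_{i_*}+1)_{n_h}}{(\kappa_{i_*}+b+n_*+1)_{|\boldsymbol n|-n_*}} .$$ Consequently, if $\zeta_1,\dots,\zeta_{|\boldsymbol n|-n_*}$ are the zeros of $H_{\boldsymbol n^{*i_*}}$ counted with multiplicity, the zeros of $\mathcal Q_{\boldsymbol n}$ are $\xi_\ell=|\boldsymbol n|-\zeta_\ell$, $\ell=1,\dots,|\boldsymbol n|-n_*$.
   Context: $(x)_n=x(x+1)\cdots(x+n-1)$; $|\boldsymbol n|=\sum n_i$; $\Delta F(t)=F(t+1)-F(t)$, $\Delta^m$ its $m$-fold iterate; $[x^k]F$ the coefficient of $x^k$. Characteristic polynomial: with $S_*(t)=\prod_{i\ne i_*}(c_i+t)_{n_i}$, $$\mathcal Q_{\boldsymbol n}(x)=\sum_{j=0}^{|\boldsymbol n|-n_*}\frac{(-1)^j(-x)_j\,(n_*-x+j+1)_{|\boldsymbol n|-n_*-j}}{(c_*+n_* )_j\,(|\boldsymbol n|-n_*-j)!}\,\Delta^{|\boldsymbol n|-n_*-j}S_*(n_*+j).$$ The type-II multiple Hahn index $\boldsymbol n^{*i_*}$ (for the weights $\omega_h$) is normal if there is a unique monic polynomial $H_{\boldsymbol n^{*i_*}}$ of degree $|\boldsymbol n|-n_*=\sum_{h\ne i_*}n_h$ with $\sum_{y=0}^{|\boldsymbol n|}H_{\boldsymbol n^{*i_*}}(y)\,y^k\omega_h(y)=0$ for $0\le k\le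 n_h-1$, $h\ne i_*$. *)

theory Defs
  imports Complex_Main "HOL-Library.Nonpos_Ints" "HOL-Library.Multiset"
    "HOL-Computational_Algebra.Polynomial"
begin

text \<open>
  Multi-indices of length \<open>p\<close> and parameter vectors are functions on \<^typ>\<open>nat\<close> of which only the
  values on \<open>{1..p}\<close> matter.  The rising factorial \<open>(x)_n\<close> is \<^const>\<open>pochhammer\<close>.
\<close>

definition msize :: "nat \<Rightarrow> (nat \<Rightarrow> nat) \<Rightarrow> nat" where
  "msize p n = (\<Sum>i=1..p. n i)"

definition fwd_diff :: "(complex \<Rightarrow> complex) \<Rightarrow> complex \<Rightarrow> complex" where
  "fwd_diff F = (\<lambda>t. F (t + 1) - F t)"

definition S_star :: "nat \<Rightarrow> (nat \<Rightarrow> complex) \<Rightarrow> (nat \<Rightarrow> nat) \<Rightarrow> nat \<Rightarrow> complex \<Rightarrow> complex" where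
  "S_star p c n istar t = (\<Prod>i\<in>{1..p} - {istar}. pochhammer (c i + t) (n i))"

text \<open>
  The characteristic polynomial is an element of \<^typ>\<open>complex poly\<close>: \<open>[:0, -1:]\<close> is \<open>-x\<close> and
  \<open>[:n\<^sub>* + j + 1, -1:]\<close> is \<open>n\<^sub>* - x + j + 1\<close>, the rising factorials being taken in the
  polynomial ring.  The lemma \<open>poly_char_Q\<close> below gives its values.
\<close>

definition char_Q :: "nat \<Rightarrow> (nat \<Rightarrow> complex) \<Rightarrow> (nat \<Rightarrow> nat) \<Rightarrow> nat \<Rightarrow> complex poly" where
  "char_Q p c n istar =
     (let ns = n istar; d = msize p n - ns in
      \<Sum>j=0..d.
        smult ((-1) ^ j / (pochhammer (c istar + of_nat ns) j * fact (d - j))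
                 * (fwd_diff ^^ (d - j)) (S_star p c n istar) (of_nat (ns + j)))
          (pochhammer [:0, -1:] j * pochhammer [:of_nat (ns + j + 1), -1:] (d - j)))"

lemma poly_pochhammer: "poly (pochhammer q m) x = pochhammer (poly q x) m"
  for q :: "complex poly"
  by (simp add: pochhammer_prod poly_prod)

lemma poly_char_Q:
  "poly (char_Q p c n istar) x =
     (let ns = n istar; d = msize p n - ns in
      \<Sum>j=0..d.
        (-1) ^ j * pochhammer (- x) j * pochhammer (of_nat ns - x + of_nat j + 1) (d - j)
          / (pochhammer (c istar + of_nat ns) j * fact (d - j))
          * (fwd_diff ^^ (d - j)) (S_star p c n istar) (of_nat (ns + j)))"
  unfolding char_Q_def Let_def poly_sum
  by (intro sum.cong refl) (simp add: poly_pochhammer algebra_simps)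

definition hahn_weight :: "complex \<Rightarrow> complex \<Rightarrow> nat \<Rightarrow> nat \<Rightarrow> complex" where
  "hahn_weight \<alpha> \<beta> N y =
     pochhammer (\<alpha> + 1) y / fact y * (pochhammer (\<beta> + 1) (N - y) / fact (N - y))"

text \<open>
  Type-II multiple orthogonality on \<open>{0..N}\<close> for a multi-index \<open>\<nu>\<close> and weights \<open>\<omega>\<close> indexed by a
  finite set \<open>I\<close>.
\<close>

definition typeII_orthogonal ::
  "nat set \<Rightarrow> (nat \<Rightarrow> nat) \<Rightarrow> (nat \<Rightarrow> nat \<Rightarrow> complex) \<Rightarrow> nat \<Rightarrow> complex poly \<Rightarrow> bool" where
  "typeII_orthogonal I \<nu> \<omega> N P \<longleftrightarrow>
     (\<forall>h\<in>I. \<forall>k<\<nu> h. (\<Sum>y=0..N. poly P (of_nat y) * of_nat y ^ k * \<omega> h y) = 0)"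

definition is_monic_typeII ::
  "nat set \<Rightarrow> (nat \<Rightarrow> nat) \<Rightarrow> (nat \<Rightarrow> nat \<Rightarrow> complex) \<Rightarrow> nat \<Rightarrow> complex poly \<Rightarrow> bool" where
  "is_monic_typeII I \<nu> \<omega> N P \<longleftrightarrow>
     lead_coeff P = 1 \<and> degree P = (\<Sum>h\<in>I. \<nu> h) \<and> typeII_orthogonal I \<nu> \<omega> N P"

definition typeII_normal ::
  "nat set \<Rightarrow> (nat \<Rightarrow> nat) \<Rightarrow> (nat \<Rightarrow> nat \<Rightarrow> complex) \<Rightarrow> nat \<Rightarrow> bool" where
  "typeII_normal I \<nu> \<omega> N \<longleftrightarrow> (\<exists>!P. is_monic_typeII I \<nu> \<omega> N P)"

definition typeII_poly ::
  "nat set \<Rightarrow> (nat \<Rightarrow> nat) \<Rightarrow> (nat \<Rightarrow> nat \<Rightarrow> complex) \<Rightarrow> nat \<Rightarrow> complex poly" where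
  "typeII_poly I \<nu> \<omega> N = (THE P. is_monic_typeII I \<nu> \<omega> N P)"

end

theory Submission
  imports Defs "HOL-Computational_Algebra.Fundamental_Theorem_Algebra"
begin

text \<open>
  Put \<open>C = c\<^sub>* + n\<^sub>*\<close> and \<open>d = N - n\<^sub>*\<close>.  At \<open>x = N - y\<close> the polynomial \<open>Q\<close> is a sum over \<open>m \<le> d\<close> of
  products of the binomial coefficients of \<open>y\<close> over \<open>m\<close> and of \<open>N - y\<close> over \<open>d - m\<close> with
  \<open>\<Delta>\<^sup>m S(N - m)\<close>.  Testing against \<open>(\<alpha>\<^sub>h + 1 + y)\<^sub>k\<close> instead of \<open>(-y)\<^sub>k\<close> merges the test polynomial with
  the weight, because \<open>(\<alpha>\<^sub>h + 1)\<^sub>y (\<alpha>\<^sub>h + 1 + y)\<^sub>k = (\<alpha>\<^sub>h + 1)\<^sub>k A\<^sub>y\<close> for the rising factorial of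
  \<open>A = \<alpha>\<^sub>h + 1 + k\<close>.  By Chu-Vandermonde the sum over \<open>y\<close> is then \<open>A\<^sub>m / m!\<close> times a factor
  independent of \<open>m\<close>, and Newton's backward formula sums the rest to \<open>S(N + A)\<close>, which has the factor
  \<open>(-(n\<^sub>h - 1 - k))\<close> raised to the rising power \<open>n\<^sub>h\<close>, hence vanishes.  The same formula evaluates the
  leading coefficient of \<open>Q\<close> as \<open>S(1 - c\<^sub>*) / (C)\<^sub>d\<close>, which is nonzero; so the reflection of \<open>Q\<close>, made
  monic, is the type-II polynomial whenever the latter is unique.
\<close>

section \<open>Forward differences of rising factorials and Newton's backward formula\<close>

lemma fwd_diff_funpow_sum:
  "(fwd_diff ^^ m) (\<lambda>t. \<Sum>r\<in>A. e r * f r t) = (\<lambda>t. \<Sum>r\<in>A. e r * (fwd_diff ^^ m) (f r) t)"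
  by (induction m) (auto simp: fwd_diff_def sum_subtractf algebra_simps)

lemma fwd_diff_pochhammer:
  "fwd_diff (\<lambda>t. pochhammer (t + a) r) t = of_nat r * pochhammer (t + a + 1) (r - 1)"
proof (cases r)
  case (Suc s)
  have "pochhammer (t + 1 + a) (Suc s) = pochhammer (t + a + 1) s * (t + a + 1 + of_nat s)"
    by (simp add: pochhammer_Suc add_ac)
  moreover have "pochhammer (t + a) (Suc s) = (t + a) * pochhammer (t + a + 1) s"
    by (simp add: pochhammer_rec)
  ultimately show ?thesis
    using Suc by (simp add: fwd_diff_def algebra_simps)
qed (simp add: fwd_diff_def)

text \<open>Each difference lowers the order and raises the base point by one, so evaluation at t -
  m, as in a backward difference, restores the base point t. For m > r the binomial coefficient is
  0, so the truncated \<open>r - m\<close> is harmless.\<close>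

lemma fwd_diff_funpow_pochhammer:
  "(fwd_diff ^^ m) (\<lambda>t. pochhammer t r) =
     (\<lambda>t. fact m * of_nat (r choose m) * pochhammer (t + of_nat m) (r - m))"
proof (induction m)
  case (Suc m)
  have "fact (Suc m) * (r choose Suc m) = fact m * (r choose m) * (r - m)"
    using binomial_absorb_comp[of r m] binomial_absorption[of m r]
    by (metis fact_Suc mult.assoc mult.commute of_nat_id)
  then have *: "fact (Suc m) * of_nat (r choose Suc m)
                  = fact m * of_nat (r choose m) * (of_nat (r - m) :: complex)"
    by (metis of_nat_fact of_nat_mult)
  have "(fwd_diff ^^ Suc m) (\<lambda>t. pochhammer t r) =
      (\<lambda>t. fact m * of_nat (r choose m) * fwd_diff (\<lambda>t. pochhammer (t + of_nat m) (r - m)) t)"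
    by (simp add: Suc.IH) (simp add: fwd_diff_def algebra_simps)
  also have "\<dots> = (\<lambda>t. fact m * of_nat (r choose m) * of_nat (r - m)
                        * pochhammer (t + of_nat (Suc m)) (r - Suc m))"
    by (simp add: fwd_diff_pochhammer add_ac mult_ac)
  finally show ?case
    by (simp only: *)
qed simp

lemma poly_eq_sum_pochhammer:
  fixes P :: "complex poly"
  assumes "degree P \<le> d"
  shows "\<exists>e. \<forall>t. poly P t = (\<Sum>r\<le>d. e r * pochhammer t r)"
  using assms
proof (induction d arbitrary: P)
  case 0
  then obtain a where "P = [:a:]" by (metis degree_0_id le_zero_eq)
  then show ?case by (auto intro: exI[of _ "\<lambda>_. a"])
next
  case (Suc d)
  obtain a R where P: "P = pCons a R" by (cases P)
  with Suc.prems have "degree R \<le> d" by (cases "R = 0") auto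
  then obtain e where e: "\<And>t. poly R t = (\<Sum>r\<le>d. e r * pochhammer t r)"
    using Suc.IH by blast
  \<comment> \<open>The coefficients come from t (t)_r = (t)_{r+1} - r (t)_r. The cutoff r <= d is
    needed because \<open>e\<close> is unconstrained beyond d.\<close>
  define g where "g = (\<lambda>r. (if r = 0 then a else e (r - 1)) - (if r \<le> d then of_nat r * e r else 0))"
  have "poly P t = (\<Sum>r\<le>Suc d. g r * pochhammer t r)" for t
  proof -
    have "t * (\<Sum>r\<le>d. e r * pochhammer t r)
        = (\<Sum>r\<le>d. e r * pochhammer t (Suc r)) - (\<Sum>r\<le>d. of_nat r * e r * pochhammer t r)"
      by (simp add: pochhammer_Suc sum_distrib_left algebra_simps flip: sum_subtractf)
    moreover have "(\<Sum>r\<le>Suc d. (if r = 0 then a else e (r - 1)) * pochhammer t r)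
        = a + (\<Sum>r\<le>d. e r * pochhammer t (Suc r))"
      by (subst sum.atMost_Suc_shift) simp
    moreover have "(\<Sum>r\<le>Suc d. (if r \<le> d then of_nat r * e r else 0) * pochhammer t r)
        = (\<Sum>r\<le>d. of_nat r * e r * pochhammer t r)"
      by simp
    ultimately show ?thesis
      unfolding g_def P left_diff_distrib sum_subtractf by (simp add: e)
  qed
  then show ?case by blast
qed

text \<open>Both sides are linear in P, so P may be taken to be a rising factorial of order r <= d.
  The formula is then the binomial theorem for rising factorials, applied to t - a = (-a) +
  t.\<close>

lemma newton_backward:
  fixes P :: "complex poly"
  assumes "degree P \<le> d"
  shows "(\<Sum>m\<le>d. pochhammer (- a) m / fact m * (fwd_diff ^^ m) (poly P) (t - of_nat m)) = poly P (t - a)"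
proof -
  obtain e where e: "\<And>t. poly P t = (\<Sum>r\<le>d. e r * pochhammer t r)"
    using poly_eq_sum_pochhammer[OF assms] by blast
  have P: "poly P = (\<lambda>t. \<Sum>r\<le>d. e r * pochhammer t r)"
    using e by blast
  have *: "(\<Sum>m\<le>d. pochhammer (- a) m * of_nat (r choose m) * pochhammer t (r - m)) = pochhammer (t - a) r"
    if "r \<le> d" for r
  proof -
    have "(\<Sum>m\<le>d. pochhammer (- a) m * of_nat (r choose m) * pochhammer t (r - m))
        = (\<Sum>m\<le>r. pochhammer (- a) m * of_nat (r choose m) * pochhammer t (r - m))"
      using that by (intro sum.mono_neutral_right) auto
    also have "\<dots> = pochhammer (- a + t) r"
      unfolding pochhammer_binomial_sum by (simp add: mult_ac)
    finally show ?thesis by simp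
  qed
  have "(\<Sum>m\<le>d. pochhammer (- a) m / fact m * (fwd_diff ^^ m) (poly P) (t - of_nat m))
      = (\<Sum>m\<le>d. \<Sum>r\<le>d. e r * (pochhammer (- a) m * of_nat (r choose m) * pochhammer t (r - m)))"
    by (simp add: P fwd_diff_funpow_sum fwd_diff_funpow_pochhammer sum_distrib_left mult_ac)
  also have "\<dots> = (\<Sum>r\<le>d. e r * pochhammer (t - a) r)"
    by (subst sum.swap) (simp add: * flip: sum_distrib_left)
  finally show ?thesis by (simp add: e)
qed

section \<open>Chu-Vandermonde sums against Hahn weights\<close>

lemma chu_vandermonde_fact:
  fixes A B :: complex
  shows "(\<Sum>z\<le>s. pochhammer A z / fact z * (pochhammer B (s - z) / fact (s - z)))
           = pochhammer (A + B) s / fact s"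
proof -
  have "pochhammer A z / fact z * (pochhammer B (s - z) / fact (s - z))
      = of_nat (s choose z) * pochhammer A z * pochhammer B (s - z) / fact s" if "z \<le> s" for z
    using that by (simp add: binomial_fact)
  then show ?thesis
    by (simp add: pochhammer_binomial_sum sum_divide_distrib)
qed

text \<open>Each binomial coefficient is absorbed by its half of the weight: C(y,m) (A)_y / y! =
  (A)_m / m! times (A+m)_{y-m} / (y-m)!, and likewise for the half in C. Chu-Vandermonde sums what
  remains. Apart from (A)_m / m!, the result depends on j and m only through j + m.\<close>

lemma binomial_weight_sum:
  fixes A C :: complex
  assumes "pochhammer C j \<noteq> 0"
  shows "(\<Sum>y\<le>s + j + m. of_nat (y choose m) * (fact j * of_nat ((s + j + m - y) choose j) / pochhammer C j)
            * (pochhammer A y / fact y * (pochhammer C (s + j + m - y) / fact (s + j + m - y))))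
         = pochhammer A m / fact m * (pochhammer (A + C + of_nat (j + m)) s / fact s)"
    (is "sum ?f _ = _")
proof -
  \<comment> \<open>The first binomial coefficient vanishes for y < m, the second for y > s +
    m.\<close>
  have "sum ?f {..s + j + m} = sum ?f {0 + m..s + m}"
    by (intro sum.mono_neutral_right) (auto simp: binomial_eq_0_iff)
  also have "\<dots> = (\<Sum>z=0..s. ?f (z + m))"
    by (rule sum.shift_bounds_cl_nat_ivl)
  also have "\<dots> = (\<Sum>z\<le>s. pochhammer A m / fact m *
      (pochhammer (A + of_nat m) z / fact z * (pochhammer (C + of_nat j) (s - z) / fact (s - z))))"
  proof (rule sum.cong)
    fix z assume "z \<in> {..s}"
    then obtain w where s: "s = z + w"
      by (metis atMost_iff le_Suc_ex)
    have 1: "pochhammer A (z + m) = pochhammer A m * pochhammer (A + of_nat m) z"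
      by (metis add.commute pochhammer_product')
    have 2: "pochhammer C (w + j) = pochhammer C j * pochhammer (C + of_nat j) w"
      by (metis add.commute pochhammer_product')
    have 3: "of_nat ((z + m) choose m) = (fact (z + m) / (fact m * fact z) :: complex)"
      by (subst binomial_fact) auto
    have 4: "of_nat ((w + j) choose j) = (fact (w + j) / (fact j * fact w) :: complex)"
      by (subst binomial_fact) auto
    have 5: "z + w + j + m - (z + m) = w + j" "z + w - z = w" by auto
    show "?f (z + m) = pochhammer A m / fact m *
      (pochhammer (A + of_nat m) z / fact z * (pochhammer (C + of_nat j) (s - z) / fact (s - z)))"
      unfolding s 5 1 2 3 4 using assms by simp
  qed auto
  also have "\<dots> = pochhammer A m / fact m * (pochhammer (A + of_nat m + (C + of_nat j)) s / fact s)"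
    by (simp only: chu_vandermonde_fact flip: sum_distrib_left)
  finally show ?thesis
    by (simp add: algebra_simps)
qed


section \<open>Rising factorials of linear polynomials and the degree of S\<close>

lemma pochhammer_uminus_of_nat:
  "(-1) ^ j * pochhammer (- of_nat x) j = fact j * (of_nat (x choose j) :: complex)"
  by (simp add: binomial_gbinomial gbinomial_pochhammer)

lemma pochhammer_linear_eq_prod:
  "pochhammer [:a, b:] k = (\<Prod>i=0..<k. [:a + of_nat i, b:])" for a b :: complex
  by (simp add: pochhammer_prod of_nat_poly)

lemma degree_pochhammer_linear:
  fixes a b :: complex
  assumes "b \<noteq> 0"
  shows "degree (pochhammer [:a, b:] k) = k"
  unfolding pochhammer_linear_eq_prod using assms by (subst degree_prod_eq_sum_degree) auto

lemma lead_coeff_pochhammer_linear: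
  fixes a b :: complex
  assumes "b \<noteq> 0"
  shows "lead_coeff (pochhammer [:a, b:] k) = b ^ k"
  unfolding pochhammer_linear_eq_prod lead_coeff_prod using assms by simp

lemma pochhammer_linear_nonzero:
  fixes a b :: complex
  assumes "b \<noteq> 0"
  shows "pochhammer [:a, b:] k \<noteq> 0"
  using lead_coeff_pochhammer_linear[OF assms, of a k] assms by fastforce

lemma S_star_eq_poly:
  "S_star p c n istar = poly (\<Prod>i\<in>{1..p} - {istar}. pochhammer [:c i, 1:] (n i))"
  by (rule ext) (simp add: S_star_def poly_prod poly_pochhammer)

lemma degree_prod_pochhammer_linear:
  fixes c :: "nat \<Rightarrow> complex"
  shows "degree (\<Prod>i\<in>A. pochhammer [:c i, 1:] (n i)) = (\<Sum>i\<in>A. n i)"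
  by (subst degree_prod_eq_sum_degree) (auto simp: pochhammer_linear_nonzero degree_pochhammer_linear)

lemma msize_minus:
  assumes "istar \<in> {1..p}"
  shows "(\<Sum>i\<in>{1..p} - {istar}. n i) = msize p n - n istar" "n istar \<le> msize p n"
proof -
  have "msize p n = n istar + (\<Sum>i\<in>{1..p} - {istar}. n i)"
    unfolding msize_def using assms by (intro sum.remove) auto
  then show "(\<Sum>i\<in>{1..p} - {istar}. n i) = msize p n - n istar" "n istar \<le> msize p n"
    by auto
qed

section \<open>Values, moments and leading coefficient of the characteristic polynomial\<close>

lemma newton_S_star:
  assumes "istar \<in> {1..p}" "d = msize p n - n istar"
  shows "(\<Sum>m\<le>d. pochhammer a m / fact m * (fwd_diff ^^ m) (S_star p c n istar) (t - of_nat m))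
           = S_star p c n istar (t + a)"
proof -
  have "degree (\<Prod>i\<in>{1..p} - {istar}. pochhammer [:c i, 1:] (n i)) \<le> d"
    unfolding degree_prod_pochhammer_linear assms(2) msize_minus(1)[OF assms(1)] by simp
  from newton_backward[OF this, of "- a" t] show ?thesis
    by (simp add: S_star_eq_poly)
qed

text \<open>At x = N - y the argument \<open>n istar - x + j + 1\<close> equals y - (d - j) + 1, so
  both rising factorials become binomial coefficients up to factorials. The sum is then reversed by
  m = d - j.\<close>

lemma poly_char_Q_of_nat:
  assumes "istar \<in> {1..p}" "N = msize p n" "d = N - n istar" "C = c istar + of_nat (n istar)" "y \<le> N"
  shows "poly (char_Q p c n istar) (of_nat N - of_nat y) =
     (\<Sum>m\<le>d. of_nat (y choose m) * (fact (d - m) * of_nat ((N - y) choose (d - m)) / pochhammer C (d - m))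
              * (fwd_diff ^^ m) (S_star p c n istar) (of_nat N - of_nat m))"
    (is "_ = (\<Sum>m\<le>d. ?f m)")
proof -
  have N: "N = n istar + d"
    using assms msize_minus(2)[OF assms(1)] by simp
  have "(-1) ^ j * pochhammer (- (of_nat N - of_nat y)) j
        * pochhammer (of_nat (n istar) - (of_nat N - of_nat y) + of_nat j + 1) (d - j)
        / (pochhammer C j * fact (d - j))
        * (fwd_diff ^^ (d - j)) (S_star p c n istar) (of_nat (n istar + j)) = ?f (d - j)"
    if "j \<le> d" for j
  proof -
    have 1: "pochhammer (of_nat (n istar) - (of_nat N - of_nat y) + of_nat j + 1) (d - j) / fact (d - j)
        = (of_nat (y choose (d - j)) :: complex)"
      using that by (simp add: N binomial_gbinomial gbinomial_pochhammer' of_nat_diff algebra_simps)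
    have 2: "(-1) ^ j * pochhammer (- (of_nat N - of_nat y)) j = fact j * (of_nat ((N - y) choose j) :: complex)"
      using pochhammer_uminus_of_nat[of j "N - y"] \<open>y \<le> N\<close> by (simp add: of_nat_diff)
    have 3: "of_nat N - of_nat (d - j) = (of_nat (n istar + j) :: complex)"
      using that by (simp add: N of_nat_diff)
    have 4: "d - (d - j) = j" using that by simp
    show ?thesis
      unfolding 2 3 4 1[symmetric] by (simp add: mult_ac)
  qed
  then have "poly (char_Q p c n istar) (of_nat N - of_nat y) = (\<Sum>j=0..d. ?f (d - j))"
    unfolding poly_char_Q Let_def assms(2-4)[symmetric] by (intro sum.cong) auto
  also have "\<dots> = (\<Sum>m\<le>d. ?f m)"
    by (rule sum.reindex_bij_witness[of _ "\<lambda>j. d - j" "\<lambda>j. d - j"]) auto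
  finally show ?thesis .
qed

text \<open>Here (d - m) + m = d makes the Chu-Vandermonde factor \<open>?K\<close> independent of
  m, and Newton's formula sums the differences. The parameter A stays free; orthogonality will come
  from choosing N + A as a zero of S.\<close>

lemma char_Q_moment:
  assumes "istar \<in> {1..p}" "N = msize p n" "d = N - n istar" "C = c istar + of_nat (n istar)"
    and "\<And>j. pochhammer C j \<noteq> 0"
  shows "(\<Sum>y\<le>N. poly (char_Q p c n istar) (of_nat N - of_nat y)
            * (pochhammer A y / fact y * (pochhammer C (N - y) / fact (N - y))))
         = pochhammer (A + C + of_nat d) (n istar) / fact (n istar) * S_star p c n istar (of_nat N + A)"
    (is "?lhs = ?K * _")
proof -
  have N: "N = n istar + d"
    using assms msize_minus(2)[OF assms(1)] by simp
  define D where "D = (\<lambda>m. (fwd_diff ^^ m) (S_star p c n istar) (of_nat N - of_nat m))"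
  have "?lhs = (\<Sum>y\<le>N. \<Sum>m\<le>d. D m * (of_nat (y choose m)
      * (fact (d - m) * of_nat ((N - y) choose (d - m)) / pochhammer C (d - m))
      * (pochhammer A y / fact y * (pochhammer C (N - y) / fact (N - y)))))"
    unfolding D_def
    by (intro sum.cong refl, subst poly_char_Q_of_nat[where c = c, OF assms(1-4)])
      (auto simp only: atMost_iff sum_distrib_right intro!: sum.cong, simp only: mult_ac)
  also have "\<dots> = (\<Sum>m\<le>d. D m * (pochhammer A m / fact m * ?K))"
  proof (subst sum.swap, rule sum.cong)
    fix m assume "m \<in> {..d}"
    then have *: "N = n istar + (d - m) + m" "d = d - m + m"
      by (auto simp: N)
    show "(\<Sum>y\<le>N. D m * (of_nat (y choose m)
      * (fact (d - m) * of_nat ((N - y) choose (d - m)) / pochhammer C (d - m))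
      * (pochhammer A y / fact y * (pochhammer C (N - y) / fact (N - y)))))
      = D m * (pochhammer A m / fact m * ?K)"
      using binomial_weight_sum[where C = C and j = "d - m" and s = "n istar" and m = m and A = A, OF assms(5)]
      by (simp only: *[symmetric] sum_distrib_left[symmetric])
  qed auto
  also have "\<dots> = ?K * (\<Sum>m\<le>d. pochhammer A m / fact m * D m)"
    by (simp add: sum_distrib_left sum_divide_distrib mult_ac)
  also have "\<dots> = ?K * S_star p c n istar (of_nat N + A)"
    unfolding D_def using newton_S_star[OF assms(1), of d n A c "of_nat N"] assms(2,3) by simp
  finally show ?thesis .
qed

text \<open>The two rising factorials in each summand multiply to a polynomial of degree d with
  leading coefficient (-1)^d, so the coefficient of Q is a sum of differences of S. It is Newton's
  formula with a = 1 - C - d at N, and N + a = 1 - \<open>c istar\<close>.\<close>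

lemma coeff_char_Q:
  assumes "istar \<in> {1..p}" "d = msize p n - n istar" "C = c istar + of_nat (n istar)"
    and "\<And>j. pochhammer C j \<noteq> 0"
  shows "coeff (char_Q p c n istar) d = S_star p c n istar (1 - c istar) / pochhammer C d"
proof -
  define N where "N = n istar + d"
  have lead: "coeff (pochhammer [:0, -1:] j * pochhammer [:a, -1:] (d - j)) d = (-1) ^ d" if "j \<le> d"
    for a :: complex and j
  proof -
    have "lead_coeff (pochhammer [:0, -1:] j * pochhammer [:a, -1:] (d - j) :: complex poly) = (-1) ^ (j + (d - j))"
      using lead_coeff_pochhammer_linear[of "-1" 0 j] lead_coeff_pochhammer_linear[of "-1" a "d - j"]
      unfolding lead_coeff_mult power_add by simp
    moreover have "degree (pochhammer [:0, -1:] j * pochhammer [:a, -1:] (d - j)) = d"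
      using that by (subst degree_mult_eq) (auto simp: pochhammer_linear_nonzero degree_pochhammer_linear)
    ultimately show ?thesis using that by simp
  qed
  \<comment> \<open>With m = d - j, this combines the splitting (C)_d = (C)_j (C+j)_m with the
    reflection (1-C-d)_m = (-1)^m (C+j)_m.\<close>
  have *: "(-1) ^ j / (pochhammer C j * fact (d - j)) * (-1) ^ d
      = pochhammer (1 - C - of_nat d) (d - j) / fact (d - j) / pochhammer C d" if "j \<le> d" for j
  proof -
    define m where "m = d - j"
    have d: "d = j + m"
      using that by (simp add: m_def)
    have 1: "pochhammer C d = pochhammer C j * pochhammer (C + of_nat j) m"
      unfolding d by (rule pochhammer_product')
    then have 2: "pochhammer (C + of_nat j) m \<noteq> 0"
      using assms(4)[of d] by auto
    have "1 - C - of_nat d = - (C + of_nat d - 1)" "C + of_nat d - 1 - of_nat m + 1 = C + of_nat j"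
      by (simp_all add: d)
    then have 3: "pochhammer (1 - C - of_nat d) m = (-1) ^ m * pochhammer (C + of_nat j) m"
      by (simp only: pochhammer_minus)
    have "(-1) ^ j * (-1) ^ d = ((-1) ^ m :: complex)"
      by (simp add: d power_add)
    then have "(-1) ^ j / (pochhammer C j * fact m) * (-1) ^ d = (-1) ^ m / (pochhammer C j * fact m)"
      by (simp only: times_divide_eq_left)
    also have "\<dots> = pochhammer (1 - C - of_nat d) m / fact m / pochhammer C d"
      unfolding 1 3 using 2 by simp
    finally show ?thesis
      by (simp only: m_def)
  qed
  have "coeff (char_Q p c n istar) d
      = (\<Sum>j=0..d. (-1) ^ j / (pochhammer C j * fact (d - j)) * (-1) ^ d
            * (fwd_diff ^^ (d - j)) (S_star p c n istar) (of_nat (n istar + j)))"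
    unfolding char_Q_def Let_def assms(2,3)[symmetric] coeff_sum coeff_smult
    by (intro sum.cong refl) (simp add: lead)
  also have "\<dots> = (\<Sum>j=0..d. pochhammer (1 - C - of_nat d) (d - j) / fact (d - j)
            * (fwd_diff ^^ (d - j)) (S_star p c n istar) (of_nat N - of_nat (d - j)) / pochhammer C d)"
    by (intro sum.cong refl, subst *) (auto simp: N_def of_nat_diff)
  also have "\<dots> = (\<Sum>m\<le>d. pochhammer (1 - C - of_nat d) m / fact m
            * (fwd_diff ^^ m) (S_star p c n istar) (of_nat N - of_nat m) / pochhammer C d)"
    by (rule sum.reindex_bij_witness[of _ "\<lambda>j. d - j" "\<lambda>j. d - j"]) auto
  also have "\<dots> = S_star p c n istar (of_nat N + (1 - C - of_nat d)) / pochhammer C d"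
    by (simp only: newton_S_star[OF assms(1,2)] flip: sum_divide_distrib)
  finally show ?thesis
    by (simp add: N_def assms(3))
qed

lemma degree_char_Q_le:
  "degree (char_Q p c n istar) \<le> msize p n - n istar"
  unfolding char_Q_def Let_def
  by (intro degree_sum_le order.trans[OF degree_smult_le] order.trans[OF degree_mult_le])
    (auto simp: degree_pochhammer_linear)

section \<open>Change of test basis and reflection of zeros\<close>

lemma sum_poly_eq_0_graded_basis:
  fixes B :: "nat \<Rightarrow> complex poly"
  assumes "\<And>k. k < \<nu> \<Longrightarrow> degree (B k) = k" "\<And>k. k < \<nu> \<Longrightarrow> B k \<noteq> 0"
    and "\<And>k. k < \<nu> \<Longrightarrow> (\<Sum>y\<in>Y. poly (B k) (x y) * f y) = 0"
    and "degree R < \<nu>"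
  shows "(\<Sum>y\<in>Y. poly R (x y) * f y) = 0"
  using assms(4)
proof (induction "degree R" arbitrary: R rule: less_induct)
  case less
  let ?k = "degree R" and ?a = "lead_coeff R / lead_coeff (B (degree R))"
  define T where "T = R - smult ?a (B ?k)"
  have B: "degree (B ?k) = ?k" "B ?k \<noteq> 0" using assms(1,2) less.prems by auto
  then have nz: "coeff (B ?k) ?k \<noteq> 0" using leading_coeff_0_iff[of "B ?k"] by simp
  \<comment> \<open>Cancelling the leading term lowers the degree, except that a constant R is
    cancelled completely.\<close>
  have "T = 0 \<or> degree T < ?k"
  proof (cases "?k = 0")
    case True
    then have "degree T = 0"
      unfolding T_def using B by (metis degree_diff_le degree_smult_le le_zero_eq)
    moreover have "coeff T 0 = 0"
      unfolding T_def using B True nz by simp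
    ultimately show ?thesis by (metis leading_coeff_0_iff)
  next
    case False
    have "degree T \<le> ?k"
      unfolding T_def using B by (metis degree_diff_le degree_smult_le le_refl)
    moreover have "coeff T ?k = 0"
      unfolding T_def using B nz by simp
    ultimately show ?thesis
      using False by (metis le_neq_implies_less leading_coeff_0_iff)
  qed
  then have "(\<Sum>y\<in>Y. poly T (x y) * f y) = 0"
    using less by fastforce
  moreover have "(\<Sum>y\<in>Y. poly R (x y) * f y)
      = (\<Sum>y\<in>Y. poly T (x y) * f y) + ?a * (\<Sum>y\<in>Y. poly (B ?k) (x y) * f y)"
    by (simp only: T_def poly_diff poly_smult left_diff_distrib sum_subtractf sum_distrib_left
        mult.assoc diff_add_cancel)
  ultimately show ?case
    using assms(3)[OF less.prems] by simp
qed

lemma proots_pcompose_reflect: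
  fixes H :: "complex poly"
  assumes "H \<noteq> 0"
  shows "proots (pcompose H [:a, -1:]) = image_mset (\<lambda>z. a - z) (proots H)"
proof -
  have fac: "pcompose [:- z, 1:] [:a, -1:] = smult (-1) [:- (a - z), 1:]" for z
    by (simp add: pcompose_pCons)
  \<comment> \<open>By induction over the roots: the factor x - z reflects to -(x - (a - z)).
    Nonvanishing is carried along because \<open>proots_mult\<close> requires it.\<close>
  have *: "proots (pcompose (\<Prod>z\<in>#M. [:- z, 1:]) [:a, -1:]) = image_mset (\<lambda>z. a - z) M
      \<and> pcompose (\<Prod>z\<in>#M. [:- z, 1:]) [:a, -1:] \<noteq> 0" for M
  proof (induction M)
    case (add x M)
    let ?R = "pcompose (\<Prod>z\<in>#M. [:- z, 1:]) [:a, -1:]"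
    have eq: "pcompose (\<Prod>z\<in>#add_mset x M. [:- z, 1:]) [:a, -1:] = smult (-1) ([:- (a - x), 1:] * ?R)"
      by (simp only: image_mset_add_mset prod_mset.add_mset pcompose_mult fac mult_smult_left)
    have "proots (smult (-1) ([:- (a - x), 1:] * ?R)) = proots ([:- (a - x), 1:] * ?R)"
      by (rule proots_smult) simp
    also have "\<dots> = proots [:- (a - x), 1:] + proots ?R"
      using add.IH by (intro proots_mult) simp_all
    also have "\<dots> = image_mset (\<lambda>z. a - z) (add_mset x M)"
      using add.IH by simp
    finally show ?case
      unfolding eq smult_eq_0_iff mult_eq_0_iff using add.IH by simp
  qed (simp add: pcompose_1)
  have "pcompose H [:a, -1:]
      = smult (lead_coeff H) (pcompose (\<Prod>z\<in>#proots H. [:- z, 1:]) [:a, -1:])"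
    by (subst complex_poly_decompose_multiset[symmetric]) (simp add: pcompose_smult)
  then show ?thesis
    using * assms by simp
qed

section \<open>Orthogonality, leading coefficient and identification with the type-II
  polynomial\<close>

theorem proposition6p9:
  fixes p :: nat and b :: complex and \<kappa> :: "nat \<Rightarrow> complex" and n :: "nat \<Rightarrow> nat" and istar :: nat
    and c :: "nat \<Rightarrow> complex" and N nstar d :: nat and I :: "nat set"
    and \<alpha> :: "nat \<Rightarrow> complex" and \<beta> :: complex and \<omega> :: "nat \<Rightarrow> nat \<Rightarrow> complex"
    and Q H :: "complex poly" and L :: complex
  assumes "p \<ge> 1"
    and "\<And>i h. i \<in> {1..p} \<Longrightarrow> h \<in> {1..p} \<Longrightarrow> i \<noteq> h \<Longrightarrow> \<kappa> i - \<kappa> h \<notin> \<int>"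
    and "\<And>i. c i = \<kappa> i + b + 1"
    and "\<And>i. i \<in> {1..p} \<Longrightarrow> c i \<notin> \<int>\<^sub>\<le>\<^sub>0"
    and "istar \<in> {1..p}"
    and "nstar = n istar"
    and "nstar = Max (n ` {1..p})"
    and "N = msize p n"
    and "d = N - nstar"
    and "Q = char_Q p c n istar"
    and "I = {1..p} - {istar}"
    and "\<And>h. \<alpha> h = - c h - of_nat N - of_nat (n h)"
    and "\<beta> = c istar + of_nat nstar - 1"
    and "\<And>h y. \<omega> h y = hahn_weight (\<alpha> h) \<beta> N y"
    and "H = typeII_poly I n \<omega> N"
    and "L = coeff Q d"
  shows
    "(\<forall>h\<in>I. \<forall>k<n h.
        (\<Sum>y=0..N. poly Q (of_nat N - of_nat y) * pochhammer (- of_nat y) k * \<omega> h y) = 0)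
     \<and> (\<forall>P. (\<forall>h\<in>I. \<forall>k<n h.
               (\<Sum>y=0..N. poly P (of_nat y) * pochhammer (- of_nat y) k * \<omega> h y) = 0)
            \<longleftrightarrow> typeII_orthogonal I n \<omega> N P)
     \<and> typeII_orthogonal I n \<omega> N (pcompose Q [:of_nat N, -1:])
     \<and> L = (\<Prod>h\<in>I. pochhammer (\<kappa> h - \<kappa> istar + 1) (n h))
             / pochhammer (\<kappa> istar + b + of_nat nstar + 1) d
     \<and> (typeII_normal I n \<omega> N \<longrightarrow>
          (\<forall>x. poly Q x = (-1) ^ d * L * poly H (of_nat N - x))
          \<and> (\<forall>\<zeta> :: nat \<Rightarrow> complex.
               proots H = image_mset \<zeta> (mset_set {1..d}) \<longrightarrow>
               proots Q = image_mset (\<lambda>l. of_nat N - \<zeta> l) (mset_set {1..d})))"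
proof -
  define C where "C = c istar + of_nat (n istar)"
  define G where "G = pcompose Q [:of_nat N, -1:]"
  have N: "N = n istar + d"
    using assms(6,8,9) msize_minus(2)[OF assms(5)] by simp
  have Q: "Q = char_Q p c n istar" and d: "d = msize p n - n istar"
    and \<omega>: "\<And>h y. \<omega> h y = hahn_weight (\<alpha> h) (C - 1) N y"
    using assms(6,8-10,13,14) by (simp_all add: C_def)
  have finI: "finite I" and card_I: "(\<Sum>h\<in>I. n h) = d"
    using msize_minus(1)[OF assms(5)] d assms(11) by simp_all
  have C_nz: "pochhammer C j \<noteq> 0" for j
  proof
    assume "pochhammer C j = 0"
    then obtain k where "C = - of_nat k" by (auto simp: pochhammer_eq_0_iff)
    then have "c istar = - of_nat (k + n istar)" by (simp add: C_def algebra_simps)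
    with assms(4)[OF assms(5)] show False by (metis minus_of_nat_in_nonpos_Ints)
  qed

  \<comment> \<open>The factor (\<alpha>_h + 1)_k is pulled out of the sum and never divided by, so
    it may vanish.\<close>
  have orth_shifted: "(\<Sum>y=0..N. poly (pochhammer [:\<alpha> h + 1, 1:] k) (of_nat y) * (poly G (of_nat y) * \<omega> h y)) = 0"
    if h: "h \<in> I" and k: "k < n h" for h k
  proof -
    let ?A = "\<alpha> h + 1 + of_nat k"
    \<comment> \<open>The terms -N - n_h in \<alpha>_h place this argument among 0, -1, ..., -(n_h -
      1), the zeros of the rising factorial of order n_h.\<close>
    have "c h + (of_nat N + ?A) = - of_nat (n h - 1 - k)"
      using k by (simp add: assms(12) of_nat_diff)
    moreover have "n h - 1 - k < n h"
      using k by simp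
    ultimately have "pochhammer (c h + (of_nat N + ?A)) (n h) = 0"
      unfolding pochhammer_eq_0_iff by blast
    then have "S_star p c n istar (of_nat N + ?A) = 0"
      unfolding S_star_def using h finI assms(11) by (intro prod_zero) auto
    then have "(\<Sum>y\<le>N. poly Q (of_nat N - of_nat y)
        * (pochhammer ?A y / fact y * (pochhammer C (N - y) / fact (N - y)))) = 0"
      using char_Q_moment[where c = c, OF assms(5,8) _ C_def C_nz, of d ?A] assms(6,9)
      by (simp add: Q)
    moreover have "(\<Sum>y=0..N. poly (pochhammer [:\<alpha> h + 1, 1:] k) (of_nat y) * (poly G (of_nat y) * \<omega> h y))
        = pochhammer (\<alpha> h + 1) k * (\<Sum>y\<le>N. poly Q (of_nat N - of_nat y)
        * (pochhammer ?A y / fact y * (pochhammer C (N - y) / fact (N - y))))"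
      unfolding sum_distrib_left atLeast0AtMost
    proof (rule sum.cong)
      fix y
      have "pochhammer (\<alpha> h + 1 + of_nat y) k * pochhammer (\<alpha> h + 1) y = pochhammer (\<alpha> h + 1) k * pochhammer ?A y"
        by (metis add.commute mult.commute pochhammer_product')
      then show "poly (pochhammer [:\<alpha> h + 1, 1:] k) (of_nat y) * (poly G (of_nat y) * \<omega> h y)
        = pochhammer (\<alpha> h + 1) k * (poly Q (of_nat N - of_nat y)
            * (pochhammer ?A y / fact y * (pochhammer C (N - y) / fact (N - y))))"
        by (simp add: poly_pochhammer G_def poly_pcompose \<omega> hahn_weight_def)
    qed auto
    ultimately show ?thesis by simp
  qed
  \<comment> \<open>The shifted rising factorials have exact degree k, so they span all test
    polynomials of degree below n_h, including (-y)_k and y^k.\<close>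
  have orth: "(\<Sum>y=0..N. poly R (of_nat y) * (poly G (of_nat y) * \<omega> h y)) = 0"
    if "h \<in> I" "degree R < n h" for h R
    by (rule sum_poly_eq_0_graded_basis[where B = "\<lambda>k. pochhammer [:\<alpha> h + 1, 1:] k" and \<nu> = "n h"])
       (use that orth_shifted in \<open>auto simp: degree_pochhammer_linear pochhammer_linear_nonzero\<close>)

  have part1: "\<forall>h\<in>I. \<forall>k<n h.
      (\<Sum>y=0..N. poly Q (of_nat N - of_nat y) * pochhammer (- of_nat y) k * \<omega> h y) = 0"
  proof (intro ballI allI impI)
    fix h k assume "h \<in> I" "k < n h"
    then show "(\<Sum>y=0..N. poly Q (of_nat N - of_nat y) * pochhammer (- of_nat y) k * \<omega> h y) = 0"
      using orth[of h "pochhammer [:0, -1:] k"]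
      by (simp add: degree_pochhammer_linear poly_pochhammer G_def poly_pcompose mult_ac)
  qed
  have orth_G: "typeII_orthogonal I n \<omega> N G"
    unfolding typeII_orthogonal_def
  proof (intro ballI allI impI)
    fix h k assume "h \<in> I" "k < n h"
    then show "(\<Sum>y=0..N. poly G (of_nat y) * of_nat y ^ k * \<omega> h y) = 0"
      using orth[of h "monom 1 k"]
      by (simp add: degree_monom_eq poly_monom mult_ac)
  qed

  have part2: "(\<forall>h\<in>I. \<forall>k<n h. (\<Sum>y=0..N. poly P (of_nat y) * pochhammer (- of_nat y) k * \<omega> h y) = 0)
      \<longleftrightarrow> typeII_orthogonal I n \<omega> N P" (is "?l \<longleftrightarrow> ?r") for P
  proof
    assume l: ?l
    show ?r
      unfolding typeII_orthogonal_def
    proof (intro ballI allI impI)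
      fix h k assume h: "h \<in> I" "k < n h"
      have "(\<Sum>y=0..N. poly (monom 1 k) (of_nat y) * (poly P (of_nat y) * \<omega> h y)) = 0"
        by (rule sum_poly_eq_0_graded_basis[where B = "\<lambda>k. pochhammer [:0, -1:] k" and \<nu> = "n h"])
           (use l h in \<open>auto simp: degree_pochhammer_linear pochhammer_linear_nonzero poly_pochhammer
                          degree_monom_eq mult_ac\<close>)
      then show "(\<Sum>y=0..N. poly P (of_nat y) * of_nat y ^ k * \<omega> h y) = 0"
        by (simp add: poly_monom mult_ac)
    qed
  next
    assume r: ?r
    show ?l
    proof (intro ballI allI impI)
      fix h k assume h: "h \<in> I" "k < n h"
      have "(\<Sum>y=0..N. poly (pochhammer [:0, -1:] k) (of_nat y) * (poly P (of_nat y) * \<omega> h y)) = 0"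
        by (rule sum_poly_eq_0_graded_basis[where B = "\<lambda>k. monom 1 k" and \<nu> = "n h"])
           (use r h in \<open>auto simp: typeII_orthogonal_def degree_pochhammer_linear degree_monom_eq
                          poly_monom mult_ac\<close>)
      then show "(\<Sum>y=0..N. poly P (of_nat y) * pochhammer (- of_nat y) k * \<omega> h y) = 0"
        by (simp add: poly_pochhammer mult_ac)
    qed
  qed

  have L: "L = (\<Prod>h\<in>I. pochhammer (\<kappa> h - \<kappa> istar + 1) (n h)) / pochhammer (\<kappa> istar + b + of_nat nstar + 1) d"
    unfolding assms(16) Q coeff_char_Q[where c = c, OF assms(5) d C_def C_nz]
    by (simp add: S_star_def assms(3,6,11) C_def algebra_simps)
  \<comment> \<open>A zero factor would make \<kappa>_h - \<kappa>_istar a negative integer.\<close>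
  have "pochhammer (\<kappa> h - \<kappa> istar + 1) (n h) \<noteq> 0" if "h \<in> I" for h
  proof
    assume "pochhammer (\<kappa> h - \<kappa> istar + 1) (n h) = 0"
    then obtain k where "\<kappa> h - \<kappa> istar + 1 = - of_nat k"
      by (auto simp: pochhammer_eq_0_iff)
    then have "\<kappa> h - \<kappa> istar = of_int (- int k - 1)"
      by (simp add: algebra_simps)
    then show False
      using assms(2)[of h istar] assms(5,11) that by (metis DiffE Ints_of_int singletonI)
  qed
  moreover have "pochhammer (\<kappa> istar + b + of_nat nstar + 1) d \<noteq> 0"
    using C_nz[of d] by (simp add: C_def assms(3,6) add_ac)
  ultimately have L_nz: "L \<noteq> 0"
    unfolding L using finI by simp

  have deg_Q: "degree Q = d"
    using degree_char_Q_le[of p c n istar] L_nz le_degree[of Q d] assms(16) Q d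
    by (intro antisym) auto
  have deg_G: "degree G = d"
    using deg_Q by (simp add: G_def degree_pcompose)
  \<comment> \<open>Composition with N - x multiplies the leading coefficient by (-1)^d, the sign in
    the final formula.\<close>
  have "lead_coeff G = lead_coeff Q * (-1) ^ degree Q"
    unfolding G_def by (subst lead_coeff_comp) auto
  then have lead_G: "lead_coeff G = (-1) ^ d * L"
    by (simp only: deg_Q assms(16) mult.commute)
  let ?e = "(-1) ^ d * L"
  have e_nz: "?e \<noteq> 0" using L_nz by simp
  have G_monic: "is_monic_typeII I n \<omega> N (smult (inverse ?e) G)"
    unfolding is_monic_typeII_def
  proof (intro conjI)
    show "lead_coeff (smult (inverse ?e) G) = 1"
      unfolding lead_coeff_smult lead_G using e_nz by (rule left_inverse)
    show "degree (smult (inverse ?e) G) = (\<Sum>h\<in>I. n h)"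
      using deg_G card_I L_nz by simp
    show "typeII_orthogonal I n \<omega> N (smult (inverse ?e) G)"
      using orth_G by (simp add: typeII_orthogonal_def mult.assoc flip: sum_distrib_left)
  qed

  have part5: "(\<forall>x. poly Q x = (-1) ^ d * L * poly H (of_nat N - x))
      \<and> (\<forall>\<zeta> :: nat \<Rightarrow> complex. proots H = image_mset \<zeta> (mset_set {1..d}) \<longrightarrow>
           proots Q = image_mset (\<lambda>l. of_nat N - \<zeta> l) (mset_set {1..d}))"
    if "typeII_normal I n \<omega> N"
  proof -
    \<comment> \<open>Normality makes the description defining \<open>H\<close> unique, and the
      normalized reflection of Q satisfies it.\<close>
    have "H = smult (inverse ?e) G"
      using the1_equality[OF that[unfolded typeII_normal_def] G_monic]
      by (simp only: assms(15) typeII_poly_def)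
    then have GH: "G = smult ?e H"
      by (simp only: smult_smult right_inverse[OF e_nz] smult_1_left)
    have "H \<noteq> 0"
      using GH lead_G e_nz by (metis leading_coeff_0_iff smult_0_right)
    have "poly G (of_nat N - x) = poly Q x" for x
      by (simp add: G_def poly_pcompose)
    then have val: "poly Q x = ?e * poly H (of_nat N - x)" for x
      by (metis GH poly_smult)
    then have "Q = smult ?e (pcompose H [:of_nat N, -1:])"
      by (intro poly_eq_poly_eq_iff[THEN iffD1] ext) (simp add: poly_pcompose)
    then have "proots Q = image_mset (\<lambda>z. of_nat N - z) (proots H)"
      using proots_pcompose_reflect[OF \<open>H \<noteq> 0\<close>, of "of_nat N"] by (simp only: proots_smult[OF e_nz])
    with val show ?thesis
      by (simp add: multiset.map_comp o_def)
  qed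
  show ?thesis
    using part1 part2 orth_G L part5 unfolding G_def by blast
qed

end
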